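(* Let $A$ be a linear relation in a linear space $\mathfrak{H}$ over $\mathbb{C}$. Then for all $\lambda,\mu\in\mathbb{C}\cup\{\infty\}$ with $\lambda\neq\mu$ one has $$\mathfrak{R}_c(A)=\mathfrak{R}_\lambda(A)\cap\mathfrak{R}_\mu(A).$$
   Context: Let $\mathfrak{H}$ be a (possibly infinite-dimensional) linear space over $\mathbb{C}$. A linear relation $A$ in $\mathfrak{H}$ is a linear subspace of $\mathfrak{H}\times\mathfrak{H}$. Put $\ker A=\{x: (x,0)\in A\}$, $\operatorname{mul}A=\{y:(0,y)\in A\}$. For $\lambda\in\mathbb{C}$, $A-\lambda=\{(x,y-\lambda x):(x,y)\in A\}$. The product of linear relations is $AB=\{(x,y): \exists z\in\mathfrak{H},\ (x,z)\in B,\ (z,y)\in A\}$, and $A^k=AA^{k-1}$ for $k\ge1$ with $A^0=I$. The root spaces are the linear subspaces $$\mathfrak{R}_\lambda(A)=\bigcup_{i=1}^\infty\ker(A-\lambda)^i\ (\lambda\in\mathbb{C}),\qquad \mathfrak{R}_\infty(A)=\bigcup_{i=1}^\infty\operatorname{mul}A^i,$$ and the singular chain space is $\mathfrak{R}_c(A)=\mathfrak{R}_0(A)\cap\mathfrak{R}_\infty(A)$. *)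

theory Defs
  imports "HOL-Analysis.Product_Vector"
begin

text \<open>
  The ambient space is a type carrying an explicit scalar multiplication \<open>s\<close> by complex
  numbers, to be constrained by the library locale \<^locale>\<open>vector_space\<close>.  Relations are
  sets of pairs.  The product \<open>AB\<close> of relations (first \<open>B\<close>, then \<open>A\<close>) is \<open>B O A\<close> in HOL
  notation, so \<open>A ^^ 0 = Id\<close> and \<open>A ^^ Suc k = A ^^ k O A\<close> say
  \<open>A\<^sup>0 = I\<close> and \<open>A\<^sup>k\<^sup>+\<^sup>1 = A A\<^sup>k\<close>.
\<close>

definition linear_relation ::
    "(complex \<Rightarrow> 'a::ab_group_add \<Rightarrow> 'a) \<Rightarrow> ('a \<times> 'a) set \<Rightarrow> bool" where
  "linear_relation s A \<longleftrightarrow> module.subspace (module_prod.scale s s) A"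

definition rel_ker :: "('a::zero \<times> 'a) set \<Rightarrow> 'a set" where
  "rel_ker A = {x. (x, 0) \<in> A}"

definition rel_mul :: "('a::zero \<times> 'a) set \<Rightarrow> 'a set" where
  "rel_mul A = {y. (0, y) \<in> A}"

definition rel_shift ::
    "(complex \<Rightarrow> 'a::ab_group_add \<Rightarrow> 'a) \<Rightarrow> ('a \<times> 'a) set \<Rightarrow> complex \<Rightarrow> ('a \<times> 'a) set" where
  "rel_shift s A z = {(x, y - s z x) | x y. (x, y) \<in> A}"

datatype ext_complex = Fin complex | Infty

fun root_space ::
    "(complex \<Rightarrow> 'a::ab_group_add \<Rightarrow> 'a) \<Rightarrow> ('a \<times> 'a) set \<Rightarrow> ext_complex \<Rightarrow> 'a set" where
  "root_space s A (Fin z) = (\<Union>i\<in>{1..}. rel_ker (rel_shift s A z ^^ i))"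
| "root_space s A Infty = (\<Union>i\<in>{1..}. rel_mul (A ^^ i))"

definition singular_chain_space ::
    "(complex \<Rightarrow> 'a::ab_group_add \<Rightarrow> 'a) \<Rightarrow> ('a \<times> 'a) set \<Rightarrow> 'a set" where
  "singular_chain_space s A = root_space s A (Fin 0) \<inter> root_space s A Infty"

end

theory Submission
  imports Defs
begin

text \<open>
  Every root space is an instance of one construction.  For a row vector \<open>(a, b) \<noteq> 0\<close> let
  \<open>root_hull a b A\<close> be the least subspace \<open>M\<close> such that \<open>(x, y) \<in> A\<close> and \<open>a x + b y \<in> M\<close>
  imply \<open>x \<in> M\<close> and \<open>y \<in> M\<close>.  Unwinding chains gives \<open>\<RR>\<^sub>\<infinity>(A)\<close> for \<open>(1, 0)\<close> and \<open>\<RR>\<^sub>\<lambda>(A)\<close> for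
  \<open>(-\<lambda>, 1)\<close>, so that the extended complex plane appears as a projective line on which no
  point is distinguished: replacing \<open>A\<close> by its image under an invertible 2 by 2 matrix merely
  moves the points (\<open>root_hull_moebius\<close>).

  It therefore suffices to show that the intersection of the hulls at two distinct points is
  contained in the hull at any further point (\<open>root_hull_Int_subset\<close>), and a matrix moves the
  first two points to \<open>\<infinity>\<close> and \<open>0\<close>.  There an element \<open>x\<close> of the intersection lies on a
  chain \<open>0 \<rightarrow> \<dots> \<rightarrow> x \<rightarrow> \<dots> \<rightarrow> 0\<close> of \<open>A\<close>.  If the further point is a complex number \<open>\<lambda>\<close>, then
  the end \<open>0\<close> of the chain belongs to \<open>M = \<RR>\<^sub>\<lambda>(A)\<close>, and membership
  in \<open>M\<close> propagates backwards along a chain that starts at \<open>0\<close>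
  (\<open>chain_from_zero_predecessor\<close>), because the chain \<open>z\<^sub>i\<^sub>+\<^sub>1 = x\<^sub>i\<^sub>+\<^sub>1 + \<lambda> z\<^sub>i\<close> satisfies
  \<open>z\<^sub>i\<^sub>+\<^sub>1 - \<lambda> z\<^sub>i = x\<^sub>i\<^sub>+\<^sub>1\<close>.

  The theorem is this inclusion read twice: once with the pair \<open>0, \<infinity>\<close> and third point
  \<open>\<lambda>\<close> or \<open>\<mu>\<close>, once with the pair \<open>\<lambda>, \<mu>\<close> and third point \<open>0\<close> or \<open>\<infinity>\<close>.
\<close>

section \<open>Linear relations and their powers\<close>

locale vector_space_relations = vector_space scale
  for scale :: "'a::field \<Rightarrow> 'b::ab_group_add \<Rightarrow> 'b" (infixr \<open>*s\<close> 75)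
begin

abbreviation linear_rel :: "('b \<times> 'b) set \<Rightarrow> bool" where
  "linear_rel B \<equiv> module.subspace (module_prod.scale scale scale) B"

lemma linear_rel_iff:
  "linear_rel B \<longleftrightarrow> (0, 0) \<in> B
     \<and> (\<forall>x y x' y'. (x, y) \<in> B \<longrightarrow> (x', y') \<in> B \<longrightarrow> (x + x', y + y') \<in> B)
     \<and> (\<forall>c x y. (x, y) \<in> B \<longrightarrow> (scale c x, scale c y) \<in> B)"
proof -
  interpret P: module_prod scale scale
    by unfold_locales
  show ?thesis
    unfolding P.p.subspace_def Ball_def split_paired_All
    by (auto simp: P.scale_prod zero_prod_def)
qed

lemma linear_rel_0: "linear_rel B \<Longrightarrow> (0, 0) \<in> B"
  and linear_rel_add:
    "linear_rel B \<Longrightarrow> (x, y) \<in> B \<Longrightarrow> (x', y') \<in> B \<Longrightarrow> (x + x', y + y') \<in> B"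
  and linear_rel_scale: "linear_rel B \<Longrightarrow> (x, y) \<in> B \<Longrightarrow> (scale c x, scale c y) \<in> B"
  unfolding linear_rel_iff by blast+

lemma linear_rel_relpow:
  assumes "linear_rel B"
  shows "linear_rel (B ^^ n)"
proof (induction n)
  case 0
  show ?case
    by (simp add: linear_rel_iff)
next
  case (Suc n)
  show ?case
    unfolding linear_rel_iff
  proof (intro conjI allI impI)
    show "(0, 0) \<in> B ^^ Suc n"
      using linear_rel_0[OF Suc] linear_rel_0[OF assms] by (rule relpow_Suc_I)
  next
    fix x y x' y'
    assume "(x, y) \<in> B ^^ Suc n" "(x', y') \<in> B ^^ Suc n"
    then obtain z z' where
      "(x, z) \<in> B ^^ n" "(z, y) \<in> B" "(x', z') \<in> B ^^ n" "(z', y') \<in> B"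
      by (meson relpow_Suc_E)
    then show "(x + x', y + y') \<in> B ^^ Suc n"
      using linear_rel_add[OF Suc] linear_rel_add[OF assms] by (meson relpow_Suc_I)
  next
    fix c x y
    assume "(x, y) \<in> B ^^ Suc n"
    then show "(scale c x, scale c y) \<in> B ^^ Suc n"
      using linear_rel_scale[OF Suc] linear_rel_scale[OF assms]
      by (meson relpow_Suc_E relpow_Suc_I)
  qed
qed

lemma relpow_from_zero_mono:
  assumes "linear_rel B" "(0, x) \<in> B ^^ n" "n \<le> m"
  shows "(0, x) \<in> B ^^ m"
proof -
  have "(0, 0) \<in> B ^^ (m - n)"
    using linear_rel_0[OF linear_rel_relpow[OF assms(1)]] .
  then have "(0, x) \<in> B ^^ (m - n) O B ^^ n"
    using assms(2) by (rule relcompI)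
  also have "B ^^ (m - n) O B ^^ n = B ^^ m"
    using assms(3) by (simp flip: relpow_add)
  finally show ?thesis .
qed


section \<open>Root spaces as least invariant subspaces\<close>

text \<open>
  The sets \<open>\<Union>i. ker (A - \<lambda>)\<^sup>i\<close> and \<open>\<Union>i. mul A\<^sup>i\<close> are subspaces only because the
  sequences increase.  Closure under the vector space operations is made part of the definition,
  so that linear changes of coordinates can be carried out by rule induction alone.
\<close>

inductive_set root_hull :: "'a \<Rightarrow> 'a \<Rightarrow> ('b \<times> 'b) set \<Rightarrow> 'b set"
  for a b :: 'a and B :: "('b \<times> 'b) set" where
  zero: "0 \<in> root_hull a b B"
| add: "x \<in> root_hull a b B \<Longrightarrow> y \<in> root_hull a b B \<Longrightarrow> x + y \<in> root_hull a b B"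
| scale: "x \<in> root_hull a b B \<Longrightarrow> scale c x \<in> root_hull a b B"
| left: "(x, y) \<in> B \<Longrightarrow> scale a x + scale b y \<in> root_hull a b B \<Longrightarrow> x \<in> root_hull a b B"
| right: "(x, y) \<in> B \<Longrightarrow> scale a x + scale b y \<in> root_hull a b B \<Longrightarrow> y \<in> root_hull a b B"

lemma subspace_root_hull: "subspace (root_hull a b B)"
  by (rule subspaceI) (auto intro: root_hull.zero root_hull.add root_hull.scale)

lemma root_hull_infinity:
  assumes "linear_rel B"
  shows "root_hull 1 0 B = (\<Union>n. rel_mul (B ^^ n))"
proof (intro set_eqI iffI)
  fix x
  assume "x \<in> root_hull 1 0 B"
  then show "x \<in> (\<Union>n. rel_mul (B ^^ n))"
  proof induction
    case zero
    show ?case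
      using linear_rel_0[OF linear_rel_relpow[OF assms]] by (auto simp: rel_mul_def)
  next
    case (add x y)
    then obtain n m where "(0, x) \<in> B ^^ n" "(0, y) \<in> B ^^ m"
      by (auto simp: rel_mul_def)
    then have "(0, x) \<in> B ^^ max n m" "(0, y) \<in> B ^^ max n m"
      by (auto intro: relpow_from_zero_mono[OF assms])
    then have "(0 + 0, x + y) \<in> B ^^ max n m"
      by (rule linear_rel_add[OF linear_rel_relpow[OF assms]])
    then show ?case
      by (auto simp: rel_mul_def)
  next
    case (scale x c)
    then obtain n where "(0, x) \<in> B ^^ n"
      by (auto simp: rel_mul_def)
    then have "(scale c 0, scale c x) \<in> B ^^ n"
      by (rule linear_rel_scale[OF linear_rel_relpow[OF assms]])
    then show ?case
      by (auto simp: rel_mul_def)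
  next
    case (left x y)
    then show ?case
      by simp
  next
    case (right x y)
    then obtain n where "(0, x) \<in> B ^^ n"
      by (auto simp: rel_mul_def)
    then have "(0, y) \<in> B ^^ Suc n"
      using right(1) by (rule relpow_Suc_I)
    then show ?case
      unfolding rel_mul_def by blast
  qed
next
  fix x
  assume "x \<in> (\<Union>n. rel_mul (B ^^ n))"
  then obtain n where "(0, x) \<in> B ^^ n"
    by (auto simp: rel_mul_def)
  then show "x \<in> root_hull 1 0 B"
  proof (induction n arbitrary: x)
    case 0
    then show ?case
      by (auto intro: root_hull.zero)
  next
    case (Suc n)
    then obtain y where "(y, x) \<in> B" "y \<in> root_hull 1 0 B"
      by auto
    then show ?case
      by (auto intro: root_hull.right)
  qed
qed


section \<open>Linear changes of coordinates\<close>

definition moebius :: "'a \<Rightarrow> 'a \<Rightarrow> 'a \<Rightarrow> 'a \<Rightarrow> ('b \<times> 'b) set \<Rightarrow> ('b \<times> 'b) set" where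
  "moebius a b c d B = {(scale a x + scale b y, scale c x + scale d y) | x y. (x, y) \<in> B}"

lemma linear_rel_moebius:
  assumes "linear_rel B"
  shows "linear_rel (moebius a b c d B)"
  unfolding linear_rel_iff
proof (intro conjI allI impI)
  show "(0, 0) \<in> moebius a b c d B"
    unfolding moebius_def using linear_rel_0[OF assms] by force
next
  fix u v u' v'
  assume "(u, v) \<in> moebius a b c d B" "(u', v') \<in> moebius a b c d B"
  then obtain x y x' y' where
    xy: "(x, y) \<in> B" "u = scale a x + scale b y" "v = scale c x + scale d y" and
    xy': "(x', y') \<in> B" "u' = scale a x' + scale b y'" "v' = scale c x' + scale d y'"
    unfolding moebius_def by blast
  have "u + u' = scale a (x + x') + scale b (y + y')"
    "v + v' = scale c (x + x') + scale d (y + y')"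
    using xy xy' by (simp_all add: scale_right_distrib)
  then show "(u + u', v + v') \<in> moebius a b c d B"
    unfolding moebius_def using linear_rel_add[OF assms xy(1) xy'(1)] by blast
next
  fix k u v
  assume "(u, v) \<in> moebius a b c d B"
  then obtain x y where
    xy: "(x, y) \<in> B" "u = scale a x + scale b y" "v = scale c x + scale d y"
    unfolding moebius_def by blast
  have "scale k u = scale a (scale k x) + scale b (scale k y)"
    "scale k v = scale c (scale k x) + scale d (scale k y)"
    using xy by (simp_all add: scale_right_distrib mult.commute)
  then show "(scale k u, scale k v) \<in> moebius a b c d B"
    unfolding moebius_def using linear_rel_scale[OF assms xy(1)] by blast
qed

lemma scale_combine:
  "scale p (scale a x + scale b y) + scale q (scale c x + scale d y)
     = scale (p * a + q * c) x + scale (p * b + q * d) y"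
  by (simp add: scale_right_distrib scale_left_distrib)

text \<open>
  In the new coordinates \<open>u = a x + b y\<close>, \<open>v = c x + d y\<close> the form \<open>p u + q v\<close> is the row vector
  \<open>(p, q)\<close> multiplied by the matrix.  A subspace contains \<open>u\<close> and \<open>v\<close> if it contains \<open>x\<close> and \<open>y\<close>;
  invertibility gives the converse.
\<close>

lemma root_hull_moebius:
  assumes det: "a * d - b * c \<noteq> 0"
  shows "root_hull p q (moebius a b c d B) = root_hull (p * a + q * c) (p * b + q * d) B"
    (is "?L = ?R")
proof (intro set_eqI iffI)
  fix w
  assume "w \<in> ?L"
  then show "w \<in> ?R"
  proof induction
    case (left u v)
    then obtain x y where
      xy: "(x, y) \<in> B" "u = scale a x + scale b y" "v = scale c x + scale d y"
      unfolding moebius_def by blast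
    then have "x \<in> ?R" "y \<in> ?R"
      using left.IH by (auto simp: scale_combine intro: root_hull.left root_hull.right)
    then show ?case
      using xy by (auto intro: root_hull.add root_hull.scale)
  next
    case (right u v)
    then obtain x y where
      xy: "(x, y) \<in> B" "u = scale a x + scale b y" "v = scale c x + scale d y"
      unfolding moebius_def by blast
    then have "x \<in> ?R" "y \<in> ?R"
      using right.IH by (auto simp: scale_combine intro: root_hull.left root_hull.right)
    then show ?case
      using xy by (auto intro: root_hull.add root_hull.scale)
  qed (auto intro: root_hull.zero root_hull.add root_hull.scale)
next
  have both: "x \<in> ?L \<and> y \<in> ?L"
    if "(x, y) \<in> B" and xy: "scale (p * a + q * c) x + scale (p * b + q * d) y \<in> ?L" for x y
  proof -
    define u v where "u = scale a x + scale b y" and "v = scale c x + scale d y"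
    have "(u, v) \<in> moebius a b c d B"
      using that(1) unfolding moebius_def u_def v_def by blast
    moreover have "scale p u + scale q v \<in> ?L"
      using xy by (simp add: u_def v_def scale_combine)
    ultimately have uv: "u \<in> ?L" "v \<in> ?L"
      by (auto intro: root_hull.left root_hull.right)
    define e where "e = inverse (a * d - b * c)"
    have e: "(a * d - b * c) * e = 1"
      using det by (simp add: e_def)
    have "x = scale (d * e) u + scale (- (b * e)) v"
    proof -
      have "d * e * a + - (b * e) * c = 1" "d * e * b + - (b * e) * d = 0"
        using e by (simp_all add: algebra_simps)
      then show ?thesis
        by (simp only: u_def v_def scale_combine scale_one scale_zero_left add_0_left add_0_right)
    qed
    moreover have "y = scale (- (c * e)) u + scale (a * e) v"
    proof -
      have "- (c * e) * a + a * e * c = 0" "- (c * e) * b + a * e * d = 1"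
        using e by (simp_all add: algebra_simps)
      then show ?thesis
        by (simp only: u_def v_def scale_combine scale_one scale_zero_left add_0_left add_0_right)
    qed
    ultimately show ?thesis
      using uv by (metis root_hull.add root_hull.scale)
  qed
  fix w
  assume "w \<in> ?R"
  then show "w \<in> ?L"
    by induction (use both in \<open>auto intro: root_hull.zero root_hull.add root_hull.scale\<close>)
qed

lemma moebius_swap: "moebius 0 1 1 0 B = B\<inverse>"
  unfolding moebius_def by auto

lemma relpow_converse: "(B\<inverse>) ^^ n = (B ^^ n)\<inverse>" for B :: "('b \<times> 'b) set"
proof (induction n)
  case 0
  show ?case
    by simp
next
  case (Suc n)
  have "(B\<inverse>) ^^ Suc n = (B O B ^^ n)\<inverse>"
    by (simp add: Suc converse_relcomp)
  also have "B O B ^^ n = B ^^ Suc n"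
    by (simp add: relpow_commute)
  finally show ?case .
qed

lemma root_hull_zero:
  assumes "linear_rel B"
  shows "root_hull 0 1 B = (\<Union>n. rel_ker (B ^^ n))"
proof -
  have "root_hull 0 1 B = root_hull 1 0 (B\<inverse>)"
    using root_hull_moebius[of 0 0 1 1 1 0 B] by (simp add: moebius_swap)
  also have "\<dots> = (\<Union>n. rel_mul ((B\<inverse>) ^^ n))"
    using linear_rel_moebius[OF assms, of 0 1 1 0] by (simp add: moebius_swap root_hull_infinity)
  also have "\<dots> = (\<Union>n. rel_ker (B ^^ n))"
    by (simp add: relpow_converse rel_mul_def rel_ker_def)
  finally show ?thesis .
qed


section \<open>Two root spaces meet inside every third one\<close>

text \<open>
  Induction on the length of the chain \<open>0 = x\<^sub>0 \<rightarrow> x\<^sub>1 \<rightarrow> \<dots> \<rightarrow> x\<^sub>n\<^sub>+\<^sub>1\<close> with \<open>x\<^sub>n\<^sub>+\<^sub>1 \<in> M\<close>.  By linearity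
  \<open>z\<^sub>0 = 0\<close>, \<open>z\<^sub>i\<^sub>+\<^sub>1 = x\<^sub>i\<^sub>+\<^sub>1 + k z\<^sub>i\<close> is again a chain, and \<open>z\<^sub>n\<^sub>+\<^sub>1 - k z\<^sub>n = x\<^sub>n\<^sub>+\<^sub>1\<close> forces
  \<open>z\<^sub>n \<in> M\<close>.  The chain of the \<open>z\<^sub>i\<close> up to \<open>i = n\<close> is thus shorter and ends in \<open>M\<close>, hence lies
  in \<open>M\<close>, and so do the differences \<open>x\<^sub>i\<^sub>+\<^sub>1 = z\<^sub>i\<^sub>+\<^sub>1 - k z\<^sub>i\<close>.
\<close>

lemma chain_from_zero_subset:
  assumes B: "linear_rel B" and M: "subspace M"
    and inv: "\<And>x y. (x, y) \<in> B \<Longrightarrow> y - scale k x \<in> M \<Longrightarrow> x \<in> M"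
    and "f 0 = 0" "\<And>i. i < n \<Longrightarrow> (f i, f (Suc i)) \<in> B" "f n \<in> M" "i \<le> n"
  shows "f i \<in> M"
  using assms(4-7)
proof (induction n arbitrary: f i)
  case 0
  then show ?case
    by simp
next
  case (Suc n)
  define z where "z = rec_nat 0 (\<lambda>i w. f (Suc i) + scale k w)"
  have z_0: "z 0 = 0" and z_Suc: "z (Suc i) = f (Suc i) + scale k (z i)" for i
    by (simp_all add: z_def)
  have chain: "(z i, z (Suc i)) \<in> B" if "i < Suc n" for i
    using that
  proof (induction i)
    case 0
    then show ?case
      using Suc.prems(1) Suc.prems(2)[of 0] by (simp add: z_0 z_Suc)
  next
    case (Suc i)
    have "(f (Suc i), f (Suc (Suc i))) \<in> B"
      using Suc.prems \<open>\<And>i. i < Suc n \<Longrightarrow> (f i, f (Suc i)) \<in> B\<close> by blast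
    moreover have "(scale k (z i), scale k (z (Suc i))) \<in> B"
      using Suc by (intro linear_rel_scale[OF B]) simp
    ultimately show ?case
      unfolding z_Suc[of "Suc i"] by (subst z_Suc[of i]) (rule linear_rel_add[OF B])
  qed
  have "z (Suc n) - scale k (z n) \<in> M"
    using Suc.prems(3) by (simp add: z_Suc)
  then have "z n \<in> M"
    using chain[of n] inv by blast
  have z_M: "z j \<in> M" if "j \<le> n" for j
    by (rule Suc.IH[of z]) (use z_0 chain \<open>z n \<in> M\<close> that in simp_all)
  show ?case
  proof (cases i)
    case 0
    then show ?thesis
      using Suc.prems(1) subspace_0[OF M] by simp
  next
    case (Suc j)
    show ?thesis
    proof (cases "j = n")
      case True
      then show ?thesis
        using Suc \<open>f (Suc n) \<in> M\<close> by simp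
    next
      case False
      then have "z (Suc j) \<in> M" "z j \<in> M"
        using Suc Suc.prems(4) by (auto intro: z_M)
      then have "z (Suc j) - scale k (z j) \<in> M"
        by (intro subspace_diff[OF M] subspace_scale[OF M])
      then show ?thesis
        using Suc by (simp add: z_Suc)
    qed
  qed
qed

lemma chain_from_zero_predecessor:
  assumes "linear_rel B" "subspace M"
    and "\<And>x y. (x, y) \<in> B \<Longrightarrow> y - scale k x \<in> M \<Longrightarrow> x \<in> M"
    and "(0, x) \<in> B ^^ n" "(x, y) \<in> B" "y \<in> M"
  shows "x \<in> M"
proof -
  obtain f where f: "f 0 = 0" "f n = x" "\<And>i. i < n \<Longrightarrow> (f i, f (Suc i)) \<in> B"
    using assms(4) by (auto simp: relpow_fun_conv)
  define g where "g = f(Suc n := y)"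
  have "g n \<in> M"
  proof (rule chain_from_zero_subset[OF assms(1,2)])
    show "g 0 = 0" "g (Suc n) \<in> M" "n \<le> Suc n"
      using f assms(6) by (simp_all add: g_def)
    show "(g i, g (Suc i)) \<in> B" if "i < Suc n" for i
      using that f assms(5) by (cases "i = n") (auto simp: g_def)
  qed (use assms(3) in blast)
  then show ?thesis
    using f by (simp add: g_def)
qed

lemma root_hull_infinity_Int_zero_subset:
  assumes B: "linear_rel B" and "(a, b) \<noteq> (0, 0)"
  shows "root_hull 1 0 B \<inter> root_hull 0 1 B \<subseteq> root_hull a b B"
proof (cases "b = 0")
  case True
  \<comment> \<open>The third point is \<open>\<infinity>\<close> itself, given by another row vector.\<close>
  then have "a \<noteq> 0"
    using assms(2) by simp
  have "x \<in> root_hull a b B" if "x \<in> root_hull 1 0 B" for x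
    using that
  proof induction
    case (right x y)
    then have "scale a x + scale b y \<in> root_hull a b B"
      using True by (auto intro: root_hull.scale)
    then show ?case
      using right(1) by (rule root_hull.right[rotated])
  qed (auto intro: root_hull.zero root_hull.add root_hull.scale)
  then show ?thesis
    by blast
next
  case False
  let ?M = "root_hull a b B"
  have inv: "x \<in> ?M" if "(x, y) \<in> B" "y - scale (- a / b) x \<in> ?M" for x y
  proof -
    have "scale b (y - scale (- a / b) x) = scale a x + scale b y"
      using False by (simp add: scale_right_distrib)
    then show ?thesis
      using that root_hull.scale[OF that(2), of b] by (auto intro: root_hull.left)
  qed
  have "x \<in> ?M" if "(0, x) \<in> B ^^ n" "(x, 0) \<in> B ^^ m" for x n m
    using that
  proof (induction m arbitrary: x n)
    case 0
    then show ?case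
      by (simp add: root_hull.zero)
  next
    case (Suc m)
    then obtain y where y: "(x, y) \<in> B" "(y, 0) \<in> B ^^ m"
      by (meson relpow_Suc_D2)
    have "y \<in> ?M"
      using relpow_Suc_I[OF Suc.prems(1) y(1)] y(2) by (rule Suc.IH)
    show ?case
      by (rule chain_from_zero_predecessor[OF B subspace_root_hull _ Suc.prems(1) y(1) \<open>y \<in> ?M\<close>])
        (erule (1) inv)
  qed
  then show ?thesis
    by (auto simp: root_hull_infinity[OF B] root_hull_zero[OF B] rel_mul_def rel_ker_def)
qed

text \<open>
  The rows \<open>(a, b)\<close> and \<open>(c, d)\<close> form a basis; in the coordinates that they define, the first two
  hulls belong to \<open>\<infinity>\<close> and \<open>0\<close>, and the third one to the coefficients of \<open>(p, q)\<close> in this basis.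
\<close>

lemma root_hull_Int_subset:
  assumes B: "linear_rel B" and det: "a * d - b * c \<noteq> 0" and "(p, q) \<noteq> (0, 0)"
  shows "root_hull a b B \<inter> root_hull c d B \<subseteq> root_hull p q B"
proof -
  define D where "D = a * d - b * c"
  define r t where "r = (p * d - q * c) / D" and "t = (a * q - b * p) / D"
  \<comment> \<open>Cramer's rule\<close>
  have pq: "r * a + t * c = p" "r * b + t * d = q"
    using det unfolding r_def t_def D_def
    by (auto simp: divide_simps) (auto simp: algebra_simps)
  then have "(r, t) \<noteq> (0, 0)"
    using assms(3) by auto
  then have "root_hull 1 0 (moebius a b c d B) \<inter> root_hull 0 1 (moebius a b c d B)
      \<subseteq> root_hull r t (moebius a b c d B)"
    by (rule root_hull_infinity_Int_zero_subset[OF linear_rel_moebius[OF B]])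
  then show ?thesis
    by (simp add: root_hull_moebius[OF det] pq)
qed

end


section \<open>The singular chain space\<close>

text \<open>
  The row vector \<open>(a, b)\<close> of a point is read off from the condition that defines its root space:
  \<open>a x + b y\<close> is \<open>y - z x\<close> at a finite point \<open>z\<close>, and \<open>x\<close> at infinity.
\<close>

fun coord_fst :: "ext_complex \<Rightarrow> complex" where
  "coord_fst (Fin z) = - z"
| "coord_fst Infty = 1"

fun coord_snd :: "ext_complex \<Rightarrow> complex" where
  "coord_snd (Fin z) = 1"
| "coord_snd Infty = 0"

lemma coord_nonzero: "(coord_fst p, coord_snd p) \<noteq> (0, 0)"
  by (cases p) auto

lemma coord_det_nonzero:
  "p \<noteq> q \<Longrightarrow> coord_fst p * coord_snd q - coord_snd p * coord_fst q \<noteq> 0"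
  by (cases p; cases q) auto

text \<open>
  The union in a root space starts at exponent 1; the exponent 0 contributes only the zero
  vector, which is already present at exponent 1.
\<close>

lemma root_space_eq_root_hull:
  assumes "vector_space s" and "linear_relation s A"
  shows "root_space s A p = vector_space_relations.root_hull s (coord_fst p) (coord_snd p) A"
proof -
  interpret vector_space_relations s
    using assms(1) by (rule vector_space_relations.intro)
  have A: "linear_rel A"
    using assms(2) by (simp add: linear_relation_def)
  have from_1: "(\<Union>i\<in>{1..}. F i) = (\<Union>i. F i)" if "F 0 \<subseteq> F 1" for F :: "nat \<Rightarrow> 'a set"
  proof (intro equalityI subsetI)
    fix x
    assume "x \<in> (\<Union>i. F i)"
    then obtain i where "x \<in> F i"
      by blast
    then show "x \<in> (\<Union>i\<in>{1..}. F i)"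
      using that by (cases "i = 0") (auto intro: bexI[of _ "max 1 i"])
  qed blast
  show ?thesis
  proof (cases p)
    case (Fin z)
    have shift: "rel_shift s A z = moebius 1 0 (- z) 1 A"
      unfolding rel_shift_def moebius_def by simp
    have S: "linear_rel (rel_shift s A z)"
      unfolding shift by (rule linear_rel_moebius[OF A])
    have "root_space s A p = (\<Union>i. rel_ker (rel_shift s A z ^^ i))"
      unfolding Fin root_space.simps
      by (rule from_1) (use linear_rel_0[OF S] in \<open>auto simp: rel_ker_def\<close>)
    also have "\<dots> = root_hull 0 1 (moebius 1 0 (- z) 1 A)"
      using root_hull_zero[OF S] by (simp add: shift)
    also have "\<dots> = root_hull (- z) 1 A"
      by (subst root_hull_moebius) simp_all
    finally show ?thesis
      by (simp add: Fin)
  next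
    case Infty
    have "root_space s A p = (\<Union>i. rel_mul (A ^^ i))"
      unfolding Infty root_space.simps
      by (rule from_1) (use linear_rel_0[OF A] in \<open>auto simp: rel_mul_def\<close>)
    then show ?thesis
      by (simp add: Infty root_hull_infinity[OF A])
  qed
qed

theorem theorem4p3:
  fixes s :: "complex \<Rightarrow> 'a::ab_group_add \<Rightarrow> 'a"
    and A :: "('a \<times> 'a) set"
    and l m :: ext_complex
  assumes "vector_space s"
    and "linear_relation s A"
    and "l \<noteq> m"
  shows "singular_chain_space s A = root_space s A l \<inter> root_space s A m"
proof -
  interpret vector_space_relations s
    using assms(1) by (rule vector_space_relations.intro)
  have A: "linear_rel A"
    using assms(2) by (simp add: linear_relation_def)
  have sub: "root_space s A p \<inter> root_space s A q \<subseteq> root_space s A r" if "p \<noteq> q" for p q r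
    unfolding root_space_eq_root_hull[OF assms(1,2)]
    by (rule root_hull_Int_subset[OF A coord_det_nonzero[OF that] coord_nonzero])
  show ?thesis
    unfolding singular_chain_space_def
    using sub[of "Fin 0" Infty l] sub[of "Fin 0" Infty m] sub[OF assms(3)] by blast
qed

end
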